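(* There exist arbitrarily long division-poor subsequences of 3-free Fibonacci sequences; that is, for every $N$ there is a 3-free Fibonacci sequence containing a division-poor subsequence of length at least $N$.
   Context: A 3-free Fibonacci sequence is a sequence $a_1,a_2,a_3,\dots$ whose two initial terms are nonnegative integers, not both zero, and for $j\ge 3$, $a_j=(a_{j-1}+a_{j-2})/3^{i_j}$, where $3^{i_j}$ ($i_j\ge 0$) is the largest power of $3$ dividing $a_{j-1}+a_{j-2}$. A division happens at step $j$ if $i_j>0$. A division-poor subsequence is a block of consecutive terms $a_s,a_{s+1},\dots,a_t$ in which division happens at exactly every other step: among the steps $j=s+2,\dots,t$, steps with $i_j>0$ and steps with $i_j=0$ alternate. *)

theory Defs
  imports "HOL-Computational_Algebra.Computational_Algebra"
begin

(* Sequences are indexed from 1: the value a 0 plays no role. All uses of the exponent below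
   have j \<ge> 3, so the subtractions on indices never truncate. *)

definition div_exponent :: "(nat \<Rightarrow> nat) \<Rightarrow> nat \<Rightarrow> nat" where
  "div_exponent a j = multiplicity 3 (a (j - 1) + a (j - 2))"

definition three_free_fibonacci :: "(nat \<Rightarrow> nat) \<Rightarrow> bool" where
  "three_free_fibonacci a \<longleftrightarrow>
     \<not> (a 1 = 0 \<and> a 2 = 0) \<and>
     (\<forall>j\<ge>3. a j = (a (j - 1) + a (j - 2)) div 3 ^ div_exponent a j)"

definition division_at :: "(nat \<Rightarrow> nat) \<Rightarrow> nat \<Rightarrow> bool" where
  "division_at a j \<longleftrightarrow> div_exponent a j > 0"

(* The block a s, ..., a t. Only the steps s + 2, ..., t, whose two predecessors both lie in the
   block, are constrained. *)
definition division_poor :: "(nat \<Rightarrow> nat) \<Rightarrow> nat \<Rightarrow> nat \<Rightarrow> bool" where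
  "division_poor a s t \<longleftrightarrow>
     1 \<le> s \<and> s \<le> t \<and>
     (\<forall>j. s + 2 \<le> j \<and> j + 1 \<le> t \<longrightarrow> (division_at a (j + 1) \<longleftrightarrow> \<not> division_at a j))"

end

theory Submission
  imports Defs
begin

text \<open>
  Suppose that steps without division alternate with divisions by exactly \<open>3\<close>. Over two steps a
  pair \<open>(a, b)\<close> of consecutive terms then becomes \<open>(a + b, (a + 2b) / 3)\<close>. If \<open>a\<close> and \<open>b\<close> are
  congruent and nonzero modulo \<open>3\<close>, then \<open>a + b\<close> is not divisible by \<open>3\<close> while \<open>a + 2b\<close> is, so the
  pattern goes on for as long as this congruence survives the linear map.

  The inverse of the map, \<open>(c, d) \<mapsto> (2c - 3d, 3d - c)\<close>, has integer coefficients and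
  takes every pair with \<open>c\<close> prime to \<open>3\<close> to a pair that satisfies the congruence. Iterating
  this inverse from \<open>(1, 1)\<close> therefore gives starting pairs on which the pattern lasts as long as
  one likes, except that their entries may be
  negative. This is repaired \<open>3\<close>-adically: the pattern over \<open>n\<close> double steps depends only on the
  starting pair modulo \<open>3 ^ (n + 1)\<close> (lemma \<open>alternates_cong\<close>), so suitable multiples of such a
  power make every backward step possible within the natural numbers (lemma
  \<open>ex_alternates\<close>).

  In terms of \<open>3\<close>-adic numbers, the starting pairs approximate an eigenvector of the map for its
  eigenvalue that is a unit, a root of \<open>3 x\<^sup>2 - 5 x + 1\<close>.
\<close>

primrec alternates :: "nat \<Rightarrow> nat \<Rightarrow> nat \<Rightarrow> bool" where
  "alternates 0 a b \<longleftrightarrow> a mod 3 \<noteq> 0 \<and> a mod 3 = b mod 3"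
| "alternates (Suc n) a b \<longleftrightarrow>
     a mod 3 \<noteq> 0 \<and> a mod 3 = b mod 3 \<and> alternates n (a + b) ((a + 2 * b) div 3)"

lemma alternates_mod_3:
  assumes "alternates n a b"
  shows "a mod 3 \<noteq> 0" "a mod 3 = b mod 3"
  using assms by (cases n; simp)+

text \<open>Each double step divides by \<open>3\<close> once and so costs one \<open>3\<close>-adic digit of precision; one more
  digit is needed for the congruence at the end.\<close>

lemma alternates_cong:
  "alternates n a b \<Longrightarrow> alternates n (a + 3 ^ Suc n * x) (b + 3 ^ Suc n * y)"
proof (induction n arbitrary: a b x y)
  case 0
  then show ?case by simp
next
  case (Suc n)
  define m :: nat where "m = 3 ^ Suc n"
  have "alternates n (a + b + m * (3 * (x + y))) ((a + 2 * b) div 3 + m * (x + 2 * y))"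
    using Suc unfolding m_def by simp
  moreover have "a + b + m * (3 * (x + y)) = (a + 3 * m * x) + (b + 3 * m * y)"
    by (simp add: algebra_simps)
  moreover have "(a + 2 * b) div 3 + m * (x + 2 * y)
      = ((a + 3 * m * x) + 2 * (b + 3 * m * y)) div 3"
  proof -
    have "(a + 3 * m * x) + 2 * (b + 3 * m * y) = (a + 2 * b) + 3 * (m * (x + 2 * y))"
      by (simp add: algebra_simps)
    then show ?thesis by simp
  qed
  moreover have "(a + 3 * m * x) mod 3 = a mod 3" "(b + 3 * m * y) mod 3 = b mod 3"
    by (simp_all add: mult.assoc)
  ultimately have "alternates (Suc n) (a + 3 * m * x) (b + 3 * m * y)"
    using Suc.prems by (simp only: alternates.simps) simp
  then show ?case unfolding m_def by simp
qed

lemma ex_alternates: "\<exists>a b. alternates n a b"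
proof (induction n)
  case 0
  have "alternates 0 1 1" by simp
  then show ?case by blast
next
  case (Suc n)
  then obtain c d where cd: "alternates n c d" by blast
  define k :: nat where "k = 3 ^ Suc n - 1"
  have k: "3 ^ Suc n = k + 1" unfolding k_def by simp
  \<comment> \<open>The preimage \<open>(2 c - 3 d, 3 d - c)\<close> of \<open>(c, d)\<close>, raised by multiples of \<open>3 ^ (n + 2)\<close>.\<close>
  define a where "a = 2 * c + 3 * k * d"
  define b where "b = 3 * d + (3 * k + 2) * c"
  have sum: "a + b = c + 3 ^ Suc n * (3 * (c + d))"
    unfolding k a_def b_def by (simp add: algebra_simps)
  have "a + 2 * b = 3 * (d + 3 ^ Suc n * (d + 2 * c))"
    unfolding k a_def b_def by (simp add: algebra_simps)
  then have quot: "(a + 2 * b) div 3 = d + 3 ^ Suc n * (d + 2 * c)"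
    by simp
  have "a mod 3 = (2 * c) mod 3"
    unfolding a_def by (simp add: mult.assoc)
  moreover have "b = 2 * c + 3 * (d + k * c)"
    unfolding b_def by (simp add: algebra_simps)
  then have "b mod 3 = (2 * c) mod 3"
    by (simp only: mod_mult_self2)
  moreover have "(2 * c) mod 3 \<noteq> 0"
    using alternates_mod_3(1)[OF cd] by presburger
  ultimately have "alternates (Suc n) a b"
    using alternates_cong[OF cd] by (simp only: alternates.simps sum quot) simp
  then show ?case by blast
qed

lemma three_free_fibonacci_step:
  assumes "three_free_fibonacci a" and "i \<ge> 1"
  shows "a (i + 2) = (a (i + 1) + a i) div 3 ^ div_exponent a (i + 2)"
proof -
  have "a (i + 2) = (a (i + 2 - 1) + a (i + 2 - 2)) div 3 ^ div_exponent a (i + 2)"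
    using assms unfolding three_free_fibonacci_def by simp
  then show ?thesis by simp
qed

lemma three_free_fibonacci_double_step:
  assumes fib: "three_free_fibonacci a" and i: "i \<ge> 1"
    and alt: "alternates (Suc n) (a i) (a (i + 1))"
  shows "\<not> division_at a (i + 2)" and "division_at a (i + 3)"
    and "alternates n (a (i + 2)) (a (i + 3))"
proof -
  let ?d = "(a i + 2 * a (i + 1)) div 3"
  have alt': "alternates n (a i + a (i + 1)) ?d"
    using alt by simp
  have "\<not> 3 dvd a (i + 1) + a i"
    using alternates_mod_3[OF alt] by presburger
  then have e2: "div_exponent a (i + 2) = 0"
    unfolding div_exponent_def by (simp add: not_dvd_imp_multiplicity_0)
  then have a2: "a (i + 2) = a (i + 1) + a i"
    using three_free_fibonacci_step[OF fib i] by simp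
  have "3 dvd a i + 2 * a (i + 1)"
    using alternates_mod_3[OF alt] by presburger
  then have sum: "a (i + 2) + a (i + 1) = 3 * ?d"
    unfolding a2 by simp
  \<comment> \<open>The congruence for the next pair makes the division exactly by \<open>3\<close>.\<close>
  have "\<not> 3 dvd ?d"
    using alternates_mod_3[OF alt'] by (metis dvd_imp_mod_0)
  moreover from this have "?d \<noteq> 0"
    by (metis dvd_0_right)
  ultimately have "multiplicity 3 (3 * ?d) = 1"
    by (subst multiplicity_times_same) (auto simp: not_dvd_imp_multiplicity_0)
  moreover have "div_exponent a (i + 3) = multiplicity 3 (a (i + 2) + a (i + 1))"
    unfolding div_exponent_def by (simp add: numeral_3_eq_3)
  ultimately have e3: "div_exponent a (i + 3) = 1"
    by (simp only: sum)
  have idx: "i + 1 + 2 = i + 3" "i + 1 + 1 = i + 2" by simp_all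
  have "a (i + 3) = (a (i + 2) + a (i + 1)) div 3 ^ div_exponent a (i + 3)"
    using three_free_fibonacci_step[OF fib, of "i + 1"] unfolding idx by simp
  then have "a (i + 3) = ?d"
    unfolding sum e3 by simp
  then show "alternates n (a (i + 2)) (a (i + 3))"
    using alt' unfolding a2 by (simp add: add.commute)
  show "\<not> division_at a (i + 2)" "division_at a (i + 3)"
    unfolding division_at_def e2 e3 by simp_all
qed

lemma division_at_iff_even:
  assumes fib: "three_free_fibonacci a" and alt: "alternates n (a 1) (a 2)"
    and j: "3 \<le> j" "j \<le> 2 * n + 2"
  shows "division_at a j \<longleftrightarrow> even j"
proof -
  have inv: "alternates (n - k) (a (2 * k + 1)) (a (2 * k + 2))" if "k \<le> n" for k
    using that
  proof (induction k)
    case 0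
    then show ?case using alt by (simp add: numeral_2_eq_2)
  next
    case (Suc k)
    then have "alternates (Suc (n - Suc k)) (a (2 * k + 1)) (a (2 * k + 1 + 1))"
      by (simp add: Suc_diff_Suc)
    from three_free_fibonacci_double_step(3)[OF fib _ this]
    show ?case by (simp add: eval_nat_numeral)
  qed
  define k where "k = (j - 3) div 2"
  have k: "k < n" and j_cases: "j = 2 * k + 1 + 2 \<or> j = 2 * k + 1 + 3"
    using j unfolding k_def by presburger+
  have alt_k: "alternates (Suc (n - Suc k)) (a (2 * k + 1)) (a (2 * k + 1 + 1))"
    using inv[of k] k by (simp add: Suc_diff_Suc)
  note step = three_free_fibonacci_double_step[OF fib _ alt_k]
  show ?thesis
    using j_cases
  proof
    assume "j = 2 * k + 1 + 2"
    then show ?thesis using step(1) by simp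
  next
    assume "j = 2 * k + 1 + 3"
    then show ?thesis using step(2) by simp
  qed
qed

text \<open>The value at \<open>0\<close> is arbitrary, since the sequences start at index \<open>1\<close>.\<close>

fun fibonacci_from :: "nat \<Rightarrow> nat \<Rightarrow> nat \<Rightarrow> nat" where
  "fibonacci_from x y 0 = 0"
| "fibonacci_from x y (Suc 0) = x"
| "fibonacci_from x y (Suc (Suc 0)) = y"
| "fibonacci_from x y (Suc (Suc (Suc n))) =
     (let z = fibonacci_from x y (Suc (Suc n)) + fibonacci_from x y (Suc n)
      in z div 3 ^ multiplicity 3 z)"

lemma three_free_fibonacci_from:
  assumes "x \<noteq> 0"
  shows "three_free_fibonacci (fibonacci_from x y)"
  unfolding three_free_fibonacci_def
proof (intro conjI allI impI)
  show "\<not> (fibonacci_from x y 1 = 0 \<and> fibonacci_from x y 2 = 0)"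
    using assms by simp
next
  fix j :: nat
  assume "3 \<le> j"
  then obtain n where "j = Suc (Suc (Suc n))"
    by (metis add_Suc numeral_3_eq_3 le_Suc_ex plus_nat.add_0)
  then show "fibonacci_from x y j =
      (fibonacci_from x y (j - 1) + fibonacci_from x y (j - 2))
        div 3 ^ div_exponent (fibonacci_from x y) j"
    by (simp add: div_exponent_def Let_def)
qed

theorem lemma9:
  fixes N :: nat
  shows "\<exists>a s t. three_free_fibonacci a \<and> division_poor a s t \<and> N \<le> t - s + 1"
proof -
  obtain x y where xy: "alternates N x y"
    using ex_alternates by blast
  define a where "a = fibonacci_from x y"
  have "x \<noteq> 0"
    using alternates_mod_3(1)[OF xy] by (metis mod_0)
  then have fib: "three_free_fibonacci a"
    unfolding a_def by (rule three_free_fibonacci_from)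
  have "alternates N (a 1) (a 2)"
    using xy unfolding a_def by (simp add: numeral_2_eq_2)
  note iff = division_at_iff_even[OF fib this]
  have "division_poor a 1 (2 * N + 2)"
    unfolding division_poor_def
  proof (intro conjI allI impI)
    fix j :: nat
    assume "1 + 2 \<le> j \<and> j + 1 \<le> 2 * N + 2"
    then show "division_at a (j + 1) \<longleftrightarrow> \<not> division_at a j"
      using iff[of j] iff[of "j + 1"] by simp
  qed simp_all
  then show ?thesis
    using fib by (intro exI[of _ a] exI[of _ 1] exI[of _ "2 * N + 2"]) simp
qed

end
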